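(* Let $\mathbb{F}_q$ be a finite field of order $q=p^s$ with $p$ prime. Let $P_1,\dots,P_r \in \mathbb{F}_q[t_1,\dots,t_n]$ be nonzero polynomials, let $f_1,\dots,f_n \in \mathbb{F}_q[t]$ be any polynomials, and let $\mathcal{I}\subseteq\{1,\dots,n\}$ be a nonempty subset. Suppose that \[ (q-1) \sum_{j=1}^r \deg_{\mathcal{I}}(P_j) < \sum_{i\in\mathcal{I}} u(f_i). \] Then $p$ divides $\# \{ (x_1,\dots,x_n) \in \mathbb{F}_q^n \mid P_j(f_1(x_1),\ldots,f_n(x_n)) = 0 \text{ for all } 1 \leq j \leq r\}$.
   Context: For $f \in \mathbb{F}_q[t]$, $u(f)$ denotes the least positive integer $\delta$ such that $\sum_{x \in \mathbb{F}_q} f(x)^{\delta} \neq 0$ if such $\delta$ exists, and $u(f)=\infty$ otherwise (with the convention $0^0=1$). For nonempty $\mathcal{I}\subseteq\{1,\dots,n\}$ and a monomial $a t_1^{m_1}\cdots t_n^{m_n}$ with $a\neq 0$, its $\mathcal{I}$-degree is $\sum_{i\in\mathcal{I}} m_i$; for $P\in\mathbb{F}_q[t_1,\dots,t_n]$, $\deg_{\mathcal{I}}(P)$ is the maximum of the $\mathcal{I}$-degrees of its monomial terms (and $\deg_{\mathcal{I}}(0)=-\infty$). *)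

theory Defs
  imports
    "HOL-Library.Poly_Mapping"
    "HOL-Library.Extended_Nat"
    "HOL-Library.Extended_Real"
    "HOL-Library.FuncSet"
    "HOL-Library.Cardinality"
    "HOL-Computational_Algebra.Polynomial"
    "HOL-Computational_Algebra.Primes"
begin

text \<open>
  A multivariate polynomial is a finitely supported map from monomials to coefficients, and a
  monomial is a finitely supported map from variable indices to exponents. The ring operations are
  those of \<^type>\<open>poly_mapping\<close> (multiplication is convolution).
\<close>

type_synonym 'a mpoly = "(nat \<Rightarrow>\<^sub>0 nat) \<Rightarrow>\<^sub>0 'a"

definition mpoly_ring :: "nat \<Rightarrow> 'a::zero mpoly set"
  where "mpoly_ring n = {P. \<forall>m\<in>Poly_Mapping.keys P. Poly_Mapping.keys m \<subseteq> {1..n}}"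

definition mpoly_eval :: "(nat \<Rightarrow> 'a) \<Rightarrow> 'a::comm_semiring_1 mpoly \<Rightarrow> 'a"
  where "mpoly_eval x P =
    (\<Sum>m\<in>Poly_Mapping.keys P. Poly_Mapping.lookup P m *
      (\<Prod>i\<in>Poly_Mapping.keys m. x i ^ Poly_Mapping.lookup m i))"

definition ideg_monom :: "nat set \<Rightarrow> (nat \<Rightarrow>\<^sub>0 nat) \<Rightarrow> nat"
  where "ideg_monom I m = (\<Sum>i\<in>I. Poly_Mapping.lookup m i)"

definition ideg :: "nat set \<Rightarrow> 'a::zero mpoly \<Rightarrow> ereal"
  where "ideg I P =
    (if P = 0 then -\<infinity> else ereal (real (Max (ideg_monom I ` Poly_Mapping.keys P))))"

definition u_of :: "'a::{field,finite} poly \<Rightarrow> enat"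
  where "u_of f =
    (if \<exists>\<delta>::nat. \<delta> > 0 \<and> (\<Sum>x\<in>UNIV. poly f x ^ \<delta>) \<noteq> 0
     then enat (LEAST \<delta>::nat. \<delta> > 0 \<and> (\<Sum>x\<in>UNIV. poly f x ^ \<delta>) \<noteq> 0)
     else \<infinity>)"

end

theory Submission
  imports Defs "HOL-Number_Theory.Residues"
begin

text \<open>
  As in Warning's proof of the Chevalley--Warning theorem, the number of solutions is, modulo
  \<open>p\<close>, the sum of \<open>\<Prod>j. (1 - P\<^sub>j(y)\<^bsup>q-1\<^esup>)\<close> over all \<open>y = (f\<^sub>1(x\<^sub>1), \<dots>, f\<^sub>n(x\<^sub>n))\<close>.
  This is a combination of monomials \<open>y\<^bsup>m\<^esup>\<close> whose \<open>I\<close>-degree is below \<open>\<Sum>i\<in>I. u(f\<^sub>i)\<close>, so some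
  \<open>i \<in> I\<close> has \<open>m\<^sub>i < u(f\<^sub>i)\<close>. The sum of \<open>y\<^bsup>m\<^esup>\<close> over all \<open>x\<close> factors over the coordinates, and
  its \<open>i\<close>-th factor vanishes by the definition of \<open>u\<close> (for \<open>m\<^sub>i = 0\<close> because \<open>q = 0\<close> in the field).
\<close>

text \<open>Multiplication by \<open>y\<close> permutes the nonzero elements; comparing their
  product before and after, the nonzero product cancels.\<close>

lemma field_power_card_minus_1:
  fixes y :: "'a::{field,finite}"
  assumes "y \<noteq> 0"
  shows "y ^ (CARD('a) - 1) = 1"
proof -
  let ?U = "UNIV - {0 :: 'a}"
  have "bij_betw ((*) y) ?U ?U"
    by (rule bij_betwI[where g = "\<lambda>z. z / y"]) (use assms in auto)
  then have "\<Prod>?U = (\<Prod>x\<in>?U. y * x)"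
    by (rule prod.reindex_bij_betw[symmetric])
  also have "\<dots> = y ^ card ?U * \<Prod>?U"
    by (simp add: prod.distrib)
  finally have "y ^ card ?U = 1"
    by simp
  then show ?thesis
    by simp
qed

lemma CHAR_eq_if_CARD_eq_prime_power:
  assumes "prime p" and "CARD('a::{field,finite}) = p ^ s"
  shows "CHAR('a) = p"
proof -
  have pos: "CHAR('a) > 0"
    by (rule finite_imp_CHAR_pos) simp
  then have "prime CHAR('a)"
    by (rule prime_CHAR_semidom)
  moreover have "CHAR('a) dvd p ^ s"
    using CHAR_dvd_CARD[where 'a = 'a] assms(2) by simp
  ultimately show ?thesis
    using assms(1) prime_dvd_power primes_dvd_imp_eq by blast
qed

text \<open>
  Polynomial functions in the variables \<open>x\<^sub>i\<close>, \<open>i \<in> A\<close>, all of whose monomials have \<open>I\<close>-degree at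
  most \<open>d\<close>. Only bounds on degrees matter, so functions can replace formal polynomials.
\<close>

inductive ideg_le :: "nat set \<Rightarrow> nat set \<Rightarrow> nat \<Rightarrow> ((nat \<Rightarrow> 'a::comm_ring_1) \<Rightarrow> 'a) \<Rightarrow> bool"
  for A I d where
  zero: "ideg_le A I d (\<lambda>x. 0)"
| add_monom: "ideg_le A I d F \<Longrightarrow> (\<Sum>i\<in>I. m i) \<le> d \<Longrightarrow>
    ideg_le A I d (\<lambda>x. c * (\<Prod>i\<in>A. x i ^ m i) + F x)"

lemma ideg_le_monom:
  assumes "(\<Sum>i\<in>I. m i) \<le> d"
  shows "ideg_le A I d (\<lambda>x. c * (\<Prod>i\<in>A. x i ^ m i))"
  using add_monom[OF zero assms, of A c] by simp

lemma ideg_le_const: "ideg_le A I d (\<lambda>x. c)"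
  using ideg_le_monom[of "\<lambda>_. 0" I d A c] by simp

lemma ideg_le_add:
  "ideg_le A I d F \<Longrightarrow> ideg_le A I d G \<Longrightarrow> ideg_le A I d (\<lambda>x. F x + G x)"
  by (induction rule: ideg_le.induct) (auto simp: add.assoc intro: ideg_le.intros)

lemma ideg_le_sum:
  assumes "\<And>k. k \<in> K \<Longrightarrow> ideg_le A I d (F k)"
  shows "ideg_le A I d (\<lambda>x. \<Sum>k\<in>K. F k x)"
  using assms by (induction K rule: infinite_finite_induct) (auto intro: zero ideg_le_add)

text \<open>Exponents add under multiplication. Fixing a single monomial on the left reduces the
  general product to an induction on one factor at a time.\<close>

lemma ideg_le_monom_mult:
  assumes "ideg_le A I e G" and "(\<Sum>i\<in>I. m i) \<le> d"
  shows "ideg_le A I (d + e) (\<lambda>x. c * (\<Prod>i\<in>A. x i ^ m i) * G x)"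
  using assms(1)
proof (induction rule: ideg_le.induct)
  case zero
  then show ?case
    by (simp add: ideg_le.zero)
next
  case (add_monom G m' c')
  have "(\<lambda>x. c * (\<Prod>i\<in>A. x i ^ m i) * (c' * (\<Prod>i\<in>A. x i ^ m' i) + G x)) =
      (\<lambda>x. c * c' * (\<Prod>i\<in>A. x i ^ (m i + m' i)) + c * (\<Prod>i\<in>A. x i ^ m i) * G x)"
    by (simp add: fun_eq_iff power_add prod.distrib algebra_simps)
  moreover have "(\<Sum>i\<in>I. m i + m' i) \<le> d + e"
    using add_monom.hyps assms(2) by (simp add: sum.distrib)
  ultimately show ?case
    using ideg_le.add_monom[OF add_monom.IH, of "\<lambda>i. m i + m' i" "c * c'"] by simp
qed

lemma ideg_le_mult:
  assumes "ideg_le A I d F" and "ideg_le A I e G"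
  shows "ideg_le A I (d + e) (\<lambda>x. F x * G x)"
  using assms(1)
proof (induction rule: ideg_le.induct)
  case zero
  then show ?case
    by (simp add: ideg_le.zero)
next
  case (add_monom F m c)
  then show ?case
    using ideg_le_add[OF ideg_le_monom_mult[OF assms(2), of m d c] add_monom.IH]
    by (simp add: distrib_right)
qed

lemma ideg_le_power:
  assumes "ideg_le A I d F"
  shows "ideg_le A I (k * d) (\<lambda>x. F x ^ k)"
proof (induction k)
  case 0
  show ?case
    by (simp add: ideg_le_const)
next
  case (Suc k)
  show ?case
    using ideg_le_mult[OF assms Suc] by simp
qed

lemma ideg_le_prod:
  assumes "finite K" and "\<And>k. k \<in> K \<Longrightarrow> ideg_le A I (d k) (F k)"
  shows "ideg_le A I (\<Sum>k\<in>K. d k) (\<lambda>x. \<Prod>k\<in>K. F k x)"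
  using assms by (induction K rule: finite_induct) (auto intro: ideg_le_const ideg_le_mult)

lemma ideg_le_mpoly_eval:
  assumes "P \<in> mpoly_ring n"
  shows "ideg_le {1..n} I (Max (ideg_monom I ` Poly_Mapping.keys P)) (\<lambda>x. mpoly_eval x P)"
  unfolding mpoly_eval_def
proof (rule ideg_le_sum)
  fix m assume m: "m \<in> Poly_Mapping.keys P"
  \<comment> \<open>Variables absent from \<open>m\<close> have exponent 0 and contribute the factor
    1.\<close>
  have "(\<Prod>i\<in>Poly_Mapping.keys m. x i ^ Poly_Mapping.lookup m i) =
      (\<Prod>i\<in>{1..n}. x i ^ Poly_Mapping.lookup m i)" for x :: "nat \<Rightarrow> 'a"
    using assms m
    by (intro prod.mono_neutral_left) (auto simp: mpoly_ring_def in_keys_iff)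
  moreover have "(\<Sum>i\<in>I. Poly_Mapping.lookup m i) \<le> Max (ideg_monom I ` Poly_Mapping.keys P)"
    unfolding ideg_monom_def[symmetric] using m by simp
  ultimately show "ideg_le {1..n} I (Max (ideg_monom I ` Poly_Mapping.keys P))
      (\<lambda>x. Poly_Mapping.lookup P m * (\<Prod>i\<in>Poly_Mapping.keys m. x i ^ Poly_Mapping.lookup m i))"
    by (simp add: ideg_le_monom)
qed

lemma sum_power_eq_0_if_less_u_of:
  fixes f :: "'a::{field,finite} poly"
  assumes "enat k < u_of f"
  shows "(\<Sum>x\<in>UNIV. poly f x ^ k) = 0"
proof (cases "k = 0")
  case True
  \<comment> \<open>\<open>u_of\<close> only tests positive exponents. For exponent 0 every term is
    1, also where \<open>f\<close> vanishes, so the sum is the field order.\<close>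
  have "of_nat CARD('a) = (0 :: 'a)"
    using CHAR_dvd_CARD[where 'a = 'a] by (simp only: of_nat_eq_0_iff_char_dvd)
  with True show ?thesis
    by simp
next
  case False
  let ?Q = "\<lambda>\<delta>. \<delta> > 0 \<and> (\<Sum>x\<in>UNIV. poly f x ^ \<delta>) \<noteq> 0"
  have "\<not> ?Q k"
  proof
    assume "?Q k"
    then have "u_of f = enat (Least ?Q)"
      unfolding u_of_def by (meson if_P)
    with assms have "k < Least ?Q"
      by simp
    with \<open>?Q k\<close> show False
      using not_less_Least by blast
  qed
  with False show ?thesis
    by simp
qed

lemma sum_ideg_le_eq_0:
  fixes f :: "nat \<Rightarrow> 'a::{field,finite} poly"
  assumes "ideg_le A I d F" and "finite A" and "I \<subseteq> A"
    and "enat d < (\<Sum>i\<in>I. u_of (f i))"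
  shows "(\<Sum>x\<in>A \<rightarrow>\<^sub>E UNIV. F (\<lambda>i. poly (f i) (x i))) = 0"
  using assms(1)
proof (induction rule: ideg_le.induct)
  case zero
  show ?case
    by simp
next
  case (add_monom F m c)
  \<comment> \<open>Otherwise summing over \<open>I\<close> would bound the sum of the
    \<open>u_of (f i)\<close> by \<open>d\<close>. Working in \<open>enat\<close> covers infinite
    values as well.\<close>
  have "\<exists>i\<in>I. enat (m i) < u_of (f i)"
  proof (rule ccontr)
    assume "\<not> ?thesis"
    then have "(\<Sum>i\<in>I. u_of (f i)) \<le> (\<Sum>i\<in>I. enat (m i))"
      by (intro sum_mono) (simp add: not_less)
    also have "\<dots> = enat (\<Sum>i\<in>I. m i)"
      by (simp add: of_nat_eq_enat[symmetric])
    also have "\<dots> \<le> enat d"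
      using add_monom.hyps by simp
    finally show False
      using assms(4) by simp
  qed
  then obtain i where "i \<in> A" "(\<Sum>x\<in>UNIV. poly (f i) x ^ m i) = 0"
    using assms(3) sum_power_eq_0_if_less_u_of by blast
  then have "(\<Prod>i\<in>A. \<Sum>x\<in>UNIV. poly (f i) x ^ m i) = 0"
    using assms(2) by auto
  moreover have "(\<Sum>x\<in>A \<rightarrow>\<^sub>E UNIV. \<Prod>i\<in>A. poly (f i) (x i) ^ m i) =
      (\<Prod>i\<in>A. \<Sum>x\<in>UNIV. poly (f i) x ^ m i)"
    using assms(2) by (subst prod_sum_PiE) auto
  ultimately show ?case
    using add_monom.IH by (simp add: sum.distrib sum_distrib_left[symmetric])
qed

theorem theorem1p4:
  fixes p s n r :: nat
    and P :: "nat \<Rightarrow> 'a::{field,finite} mpoly"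
    and f :: "nat \<Rightarrow> 'a poly"
    and I :: "nat set"
  assumes "prime p"
    and "CARD('a) = p ^ s"
    and "\<And>j. j \<in> {1..r} \<Longrightarrow> P j \<in> mpoly_ring n"
    and "\<And>j. j \<in> {1..r} \<Longrightarrow> P j \<noteq> 0"
    and "I \<subseteq> {1..n}"
    and "I \<noteq> {}"
    and "ereal (real (CARD('a) - 1)) * (\<Sum>j=1..r. ideg I (P j)) < ereal_of_enat (\<Sum>i\<in>I. u_of (f i))"
  shows "p dvd card {x \<in> {1..n} \<rightarrow>\<^sub>E (UNIV :: 'a set).
           \<forall>j\<in>{1..r}. mpoly_eval (\<lambda>i. poly (f i) (x i)) (P j) = 0}"
proof -
  define q where "q = CARD('a)"
  define d where "d j = Max (ideg_monom I ` Poly_Mapping.keys (P j))" for j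
  define D where "D = (\<Sum>j=1..r. (q - 1) * d j)"
  define F where "F x = (\<Prod>j=1..r. 1 - mpoly_eval x (P j) ^ (q - 1))" for x :: "nat \<Rightarrow> 'a"
  let ?X = "{1..n} \<rightarrow>\<^sub>E (UNIV :: 'a set)"
  let ?y = "\<lambda>x i. poly (f i) (x i)"
  let ?S = "{x \<in> ?X. \<forall>j\<in>{1..r}. mpoly_eval (?y x) (P j) = 0}"

  have "card (UNIV :: 'a set) \<ge> card {0, 1 :: 'a}"
    by (rule card_mono) auto
  then have q: "q > 1"
    by (simp add: q_def)

  \<comment> \<open>All \<open>P j\<close> are nonzero, so no degree is \<open>-\<infinity>\<close>
    and the hypothesis becomes a bound on the natural number \<open>D\<close>.\<close>
  have "(\<Sum>j=1..r. ideg I (P j)) = ereal (\<Sum>j=1..r. real (d j))"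
    using assms(4) by (simp add: ideg_def d_def)
  then have "ereal (real (CARD('a) - 1)) * (\<Sum>j=1..r. ideg I (P j)) = ereal_of_enat (enat D)"
    by (simp add: D_def q_def sum_distrib_left)
  then have D: "enat D < (\<Sum>i\<in>I. u_of (f i))"
    using assms(7) by (simp only: ereal_of_enat_less_iff)

  have "ideg_le {1..n} I ((q - 1) * d j) (\<lambda>x. 1 - mpoly_eval x (P j) ^ (q - 1))"
    if "j \<in> {1..r}" for j
  proof -
    have "ideg_le {1..n} I ((q - 1) * d j) (\<lambda>x. mpoly_eval x (P j) ^ (q - 1))"
      unfolding d_def using that assms(3) by (intro ideg_le_power ideg_le_mpoly_eval)
    \<comment> \<open>Negation is multiplication by the constant -1, of degree 0, so the bound is
      unchanged.\<close>
    from ideg_le_mult[OF ideg_le_const[of _ _ 0 "-1"] this]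
    show ?thesis
      using ideg_le_add[OF ideg_le_const[of _ _ _ 1]] by fastforce
  qed
  then have "ideg_le {1..n} I D F"
    unfolding D_def F_def by (intro ideg_le_prod) auto
  then have "(\<Sum>x\<in>?X. F (?y x)) = 0"
    using assms(5) D by (intro sum_ideg_le_eq_0) auto
  \<comment> \<open>A nonzero value of some \<open>P j\<close> makes its factor
    \<open>1 - 1\<close>; if all values vanish, each factor is 1, since \<open>q - 1 > 0\<close>
    gives \<open>0 ^ (q - 1) = 0\<close>.\<close>
  moreover have "F (?y x) = (if x \<in> ?S then 1 else 0)" if "x \<in> ?X" for x
    using that q field_power_card_minus_1[where 'a = 'a]
    by (auto simp: F_def q_def[symmetric] power_0_left)
  ultimately have "(\<Sum>x\<in>?X. if x \<in> ?S then 1 else 0) = (0 :: 'a)"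
    by simp
  moreover have "finite ?X"
    by (intro finite_PiE) auto
  ultimately have "of_nat (card ?S) = (0 :: 'a)"
    by (simp add: sum.If_cases Int_def)
  then show ?thesis
    using CHAR_eq_if_CARD_eq_prime_power[OF assms(1,2)] by (simp add: of_nat_eq_0_iff_char_dvd)
qed

end
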